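(* Let $X$ and $Y$ be smooth projective geometrically connected surfaces over $\mathbf{F}_q$ and let $\varphi:Y\to X$ be a finite morphism. Let $\mathcal{P}$ be a non-empty set of $\mathbf{F}_q$-rational points of $X$ and $\mathcal{P}_0$ be a non-empty set of $\mathbf{F}_q$-rational points of $Y$ such that $\varphi(\mathcal{P}_0)\subseteq\mathcal{P}$. If $\Gamma$ is a $\mathcal{P}$-interpolating linear system on $X$, then $\varphi^*\Gamma$ is $\mathcal{P}_0$-interpolating.
   Context: For a surface $X$ over $\mathbf{F}_q$, $\overline{X}=X\times_{\mathrm{Spec}(\mathbf{F}_q)}\mathrm{Spec}(\overline{\mathbf{F}}_q)$. A linear system "on $X$" here means a linear system on $\overline X$: a family $\Gamma$ of linearly equivalent positive (effective) divisors on $\overline X$ parametrised by a linear subspace of $\mathbf{P}(\mathrm{H}^0(\overline{X},D))$ for some divisor $D$ (not necessarily defined over $\mathbf{F}_q$). The pullback $\varphi^*\Gamma$ is the linear system on $\overline Y$ consisting of the divisors $\varphi^*H$, $H\in\Gamma$. For a proper closed subscheme $\overline{Z}\subset\overline{X}$, $\Gamma-\overline{Z}$ denotes the maximal linear subsystem of $\Gamma$ of elements whose base locus contains $\overline{Z}$ (that is, the members of $\Gamma$ containing $\overline Z$). For a set $\mathcal{P}$ of rational points of $X$, $\Gamma$ is called $\mathcal{P}$-interpolating if (i) $\Gamma-\mathcal{P}$ is non-empty, and (ii) the base locus of $\Gamma-\mathcal{P}$ has dimension $0$; similarly on $Y$. *)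

theory Defs
  imports
    "HOL-Analysis.Analysis"
    "HOL-Library.Poly_Mapping"
    "HOL-Algebra.Algebraic_Closure_Type"
begin

text \<open>
  Reduced projective schemes over a perfect field \<open>k\<close> are treated as classical varieties: a closed
  subscheme \<open>\<X>\<close> of \<open>\<bbbP>\<^sup>n\<close> over \<open>k\<close> is given by the set of its geometric points, i.e. of points with
  coordinates in an algebraic closure \<open>K\<close> of \<open>k\<close>. Every notion that depends on a field of
  definition takes as first argument \<open>C\<close> the subfield of \<open>K\<close> in which coefficients are allowed:
  \<open>C = k\<close> gives the Zariski topology, the regular functions, etc., of \<open>\<X>\<close> itself, and \<open>C = UNIV\<close>
  gives those of the base change of \<open>\<X>\<close> to \<open>K\<close>.
\<close>

section \<open>Multivariate polynomials\<close>

type_synonym ('v, 'k) mpoly = "('v \<Rightarrow>\<^sub>0 nat) \<Rightarrow>\<^sub>0 'k"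

definition eval_mpoly :: "('v, 'k::comm_semiring_1) mpoly \<Rightarrow> ('v \<Rightarrow> 'k) \<Rightarrow> 'k" where
  "eval_mpoly p v = (\<Sum>m\<in>Poly_Mapping.keys p.
     Poly_Mapping.lookup p m * (\<Prod>i\<in>Poly_Mapping.keys m. v i ^ Poly_Mapping.lookup m i))"

definition polys_over :: "'k::zero set \<Rightarrow> ('v, 'k) mpoly set" where
  "polys_over C = {p. \<forall>m\<in>Poly_Mapping.keys p. Poly_Mapping.lookup p m \<in> C}"

definition forms :: "'k::zero set \<Rightarrow> nat \<Rightarrow> ('v, 'k) mpoly set" where
  "forms C d = {p \<in> polys_over C. \<forall>m\<in>Poly_Mapping.keys p.
     (\<Sum>i\<in>Poly_Mapping.keys m. Poly_Mapping.lookup m i) = d}"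

definition partial_deriv :: "'v \<Rightarrow> ('v, 'k::comm_semiring_1) mpoly \<Rightarrow> ('v, 'k) mpoly" where
  "partial_deriv i p = (\<Sum>m\<in>Poly_Mapping.keys p.
     Poly_Mapping.single (m - Poly_Mapping.single i 1)
       (of_nat (Poly_Mapping.lookup m i) * Poly_Mapping.lookup p m))"

section \<open>Projective varieties\<close>

text \<open>
  Homogeneous coordinates are indexed by a finite type \<open>'n\<close>, so that the ambient space has dimension
  \<open>CARD('n) - 1\<close>. A point is the set of all its vectors of homogeneous coordinates.
\<close>

type_synonym ('k, 'n) point = "('k ^ 'n) set"

definition line_of :: "'k::field ^ 'n \<Rightarrow> ('k, 'n) point" where
  "line_of v = {c *s v | c. c \<noteq> 0}"

definition proj_space :: "('k::field, 'n::finite) point set" where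
  "proj_space = {line_of v | v. v \<noteq> 0}"

definition projective_over :: "'k set \<Rightarrow> ('k::field, 'n::finite) point set \<Rightarrow> bool" where
  "projective_over C \<X> \<longleftrightarrow> (\<exists>S \<subseteq> (\<Union>d. forms C d).
     \<X> = {x \<in> proj_space. \<forall>F\<in>S. \<forall>v\<in>x. eval_mpoly F (vec_nth v) = 0})"

definition zariski :: "'k set \<Rightarrow> ('k::field, 'n::finite) point set \<Rightarrow> ('k, 'n) point topology" where
  "zariski C \<X> = topology_generated_by
     {{x \<in> \<X>. \<forall>v\<in>x. eval_mpoly F (vec_nth v) \<noteq> 0} | F. F \<in> (\<Union>d. forms C d)}"

definition irreducible_in :: "'p topology \<Rightarrow> 'p set \<Rightarrow> bool" where
  "irreducible_in T Z \<longleftrightarrow> Z \<noteq> {} \<and> Z \<subseteq> topspace T \<and>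
     (\<forall>A B. closedin T A \<and> closedin T B \<and> Z \<subseteq> A \<union> B \<longrightarrow> Z \<subseteq> A \<or> Z \<subseteq> B)"

definition irreducible_chain :: "'p topology \<Rightarrow> nat \<Rightarrow> bool" where
  "irreducible_chain T d \<longleftrightarrow> (\<exists>Z :: nat \<Rightarrow> 'p set.
     (\<forall>i\<le>d. closedin T (Z i) \<and> irreducible_in T (Z i)) \<and> (\<forall>i<d. Z i \<subset> Z (Suc i)))"

text \<open>Krull dimension, as a predicate; the empty space has no dimension \<open>d \<ge> 0\<close>.\<close>

definition has_dim :: "'p topology \<Rightarrow> nat \<Rightarrow> bool" where
  "has_dim T d \<longleftrightarrow> irreducible_chain T d \<and> \<not> irreducible_chain T (Suc d)"

definition vanishing_forms :: "('k::field, 'n::finite) point set \<Rightarrow> ('n, 'k) mpoly set" where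
  "vanishing_forms \<X> = {F \<in> (\<Union>d. forms UNIV d). \<forall>x\<in>\<X>. \<forall>v\<in>x. eval_mpoly F (vec_nth v) = 0}"

definition gradient :: "('n, 'k) mpoly \<Rightarrow> 'k ^ 'n \<Rightarrow> ('k::field) ^ 'n::finite" where
  "gradient F v = (\<chi> i. eval_mpoly (partial_deriv i F) (vec_nth v))"

text \<open>
  Smooth of dimension \<open>d\<close>: at every geometric point the Jacobian matrix of the homogeneous ideal has
  rank \<open>n - d\<close>, where \<open>n + 1 = CARD('n)\<close>. Over a perfect field the ideal of the base change is
  generated by that of \<open>\<X>\<close>, so it does not matter that the ideal is taken over \<open>K\<close>.
\<close>

definition smooth_of_dim :: "nat \<Rightarrow> ('k::field, 'n::finite) point set \<Rightarrow> bool" where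
  "smooth_of_dim d \<X> \<longleftrightarrow>
     (\<forall>x\<in>\<X>. \<forall>v\<in>x. vec.dim {gradient F v | F. F \<in> vanishing_forms \<X>} + d + 1 = CARD('n))"

abbreviation base_field :: "'a::field alg_closure set" where
  "base_field \<equiv> range to_ac"

definition smooth_projective_surface :: "('a::field alg_closure, 'n::finite) point set \<Rightarrow> bool" where
  "smooth_projective_surface \<X> \<longleftrightarrow>
     projective_over base_field \<X> \<and> has_dim (zariski UNIV \<X>) 2 \<and> smooth_of_dim 2 \<X>"

definition geometrically_connected :: "('k::field, 'n::finite) point set \<Rightarrow> bool" where
  "geometrically_connected \<X> \<longleftrightarrow> connected_space (zariski UNIV \<X>)"

definition rational_points ::
    "('a::field alg_closure, 'n::finite) point set \<Rightarrow> ('a alg_closure, 'n) point set" where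
  "rational_points \<X> = {x \<in> \<X>. \<exists>v\<in>x. \<forall>i. vec_nth v i \<in> base_field}"

section \<open>Regular functions and finite morphisms\<close>

text \<open>
  A function regular on an open set \<open>U\<close> is represented by a total function; its values outside \<open>U\<close>
  are irrelevant.
\<close>

definition regular_at ::
    "'k set \<Rightarrow> ('k::field, 'n::finite) point set \<Rightarrow> (('k, 'n) point \<Rightarrow> 'k) \<Rightarrow> ('k, 'n) point \<Rightarrow> bool" where
  "regular_at C \<X> f x \<longleftrightarrow> (\<exists>d. \<exists>F\<in>forms C d. \<exists>G\<in>forms C d. \<exists>W. openin (zariski C \<X>) W \<and> x \<in> W \<and>
     (\<forall>z\<in>W. \<forall>v\<in>z. eval_mpoly G (vec_nth v) \<noteq> 0 \<and> f z = eval_mpoly F (vec_nth v) / eval_mpoly G (vec_nth v)))"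

definition regular_on ::
    "'k set \<Rightarrow> ('k::field, 'n::finite) point set \<Rightarrow> ('k, 'n) point set \<Rightarrow> (('k, 'n) point \<Rightarrow> 'k) set" where
  "regular_on C \<X> U = {f. \<forall>x\<in>U. regular_at C \<X> f x}"

text \<open>
  \<open>z\<close> is a line and does not contain \<open>0\<close>, so the condition below says that the forms \<open>F i\<close> have no
  common zero on \<open>W\<close> and that \<open>\<phi>\<close> is \<open>[F\<^sub>0 : \<dots> : F\<^sub>n]\<close> there.
\<close>

definition morphism :: "'k set \<Rightarrow> ('k::field, 'm::finite) point set \<Rightarrow> ('k, 'n::finite) point set \<Rightarrow>
    (('k, 'm) point \<Rightarrow> ('k, 'n) point) \<Rightarrow> bool" where
  "morphism C \<Y> \<X> \<phi> \<longleftrightarrow> \<phi> ` \<Y> \<subseteq> \<X> \<and>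
     (\<forall>y\<in>\<Y>. \<exists>d F W. (\<forall>i. F i \<in> forms C d) \<and> openin (zariski C \<Y>) W \<and> y \<in> W \<and>
        (\<forall>z\<in>W. \<forall>v\<in>z. (\<chi> i. eval_mpoly (F i) (vec_nth v)) \<in> \<phi> z))"

text \<open>
  Affine \<open>N\<close>-space is the set of sequences that vanish from index \<open>N\<close> on. An open set \<open>U\<close> is affine if
  some regular functions \<open>f\<^sub>0, \<dots>, f\<^sub>N\<^sub>-\<^sub>1\<close> on \<open>U\<close> define an isomorphism of \<open>U\<close> onto a Zariski closed
  subset of affine \<open>N\<close>-space; the last clause says that the inverse map is a morphism, given around
  the image of \<open>u\<close> (where \<open>h \<noteq> 0\<close>) by polynomials \<open>G i\<close> as homogeneous coordinates.
\<close>

definition affine_closed :: "'k set \<Rightarrow> nat \<Rightarrow> (nat \<Rightarrow> 'k::field) set \<Rightarrow> bool" where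
  "affine_closed C N A \<longleftrightarrow> (\<exists>S \<subseteq> polys_over C. A = {t. (\<forall>i\<ge>N. t i = 0) \<and> (\<forall>F\<in>S. eval_mpoly F t = 0)})"

definition affine_open ::
    "'k set \<Rightarrow> ('k::field, 'n::finite) point set \<Rightarrow> ('k, 'n) point set \<Rightarrow> bool" where
  "affine_open C \<X> U \<longleftrightarrow> openin (zariski C \<X>) U \<and>
     (\<exists>N f A. (\<forall>i<N. f i \<in> regular_on C \<X> U) \<and> affine_closed C N A \<and>
        (let t = (\<lambda>u i. if i < N then f i u else 0) in
           bij_betw t U A \<and>
           (\<forall>u\<in>U. \<exists>G h. (\<forall>i. G i \<in> polys_over C) \<and> h \<in> polys_over C \<and> eval_mpoly h (t u) \<noteq> 0 \<and>
              (\<forall>w\<in>U. eval_mpoly h (t w) \<noteq> 0 \<longrightarrow> (\<chi> i. eval_mpoly (G i) (t w)) \<in> w))))"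

definition finite_morphism :: "'k set \<Rightarrow> ('k::field, 'm::finite) point set \<Rightarrow>
    ('k, 'n::finite) point set \<Rightarrow> (('k, 'm) point \<Rightarrow> ('k, 'n) point) \<Rightarrow> bool" where
  "finite_morphism C \<Y> \<X> \<phi> \<longleftrightarrow> morphism C \<Y> \<X> \<phi> \<and>
     (\<forall>x\<in>\<X>. \<exists>U. x \<in> U \<and> affine_open C \<X> U \<and>
        (let V = {y \<in> \<Y>. \<phi> y \<in> U} in
           affine_open C \<Y> V \<and>
           (\<exists>B. finite B \<and> B \<subseteq> regular_on C \<Y> V \<and>
              (\<forall>b\<in>regular_on C \<Y> V. \<exists>a. (\<forall>g\<in>B. a g \<in> regular_on C \<X> U) \<and>
                 (\<forall>y\<in>V. b y = (\<Sum>g\<in>B. a g (\<phi> y) * g y))))))"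

section \<open>Divisors and linear systems over the algebraic closure\<close>

text \<open>
  A rational function is represented by any total function that is regular on a dense open set; two
  of them represent the same element of the function field iff they agree on a dense open set
  (\<open>rat_eq\<close>).
\<close>

definition dense_open :: "('k::field, 'n::finite) point set \<Rightarrow> ('k, 'n) point set \<Rightarrow> bool" where
  "dense_open \<X> U \<longleftrightarrow> openin (zariski UNIV \<X>) U \<and> zariski UNIV \<X> closure_of U = \<X>"

definition rational_function ::
    "('k::field, 'n::finite) point set \<Rightarrow> (('k, 'n) point \<Rightarrow> 'k) \<Rightarrow> bool" where
  "rational_function \<X> f \<longleftrightarrow> (\<exists>U. dense_open \<X> U \<and> f \<in> regular_on UNIV \<X> U)"

definition rat_eq :: "('k::field, 'n::finite) point set \<Rightarrow>
    (('k, 'n) point \<Rightarrow> 'k) \<Rightarrow> (('k, 'n) point \<Rightarrow> 'k) \<Rightarrow> bool" where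
  "rat_eq \<X> f g \<longleftrightarrow> (\<exists>U. dense_open \<X> U \<and> (\<forall>z\<in>U. f z = g z))"

definition invertible_rational ::
    "('k::field, 'n::finite) point set \<Rightarrow> (('k, 'n) point \<Rightarrow> 'k) \<Rightarrow> bool" where
  "invertible_rational \<X> f \<longleftrightarrow> rational_function \<X> f \<and>
     (\<exists>g. rational_function \<X> g \<and> rat_eq \<X> (\<lambda>z. f z * g z) (\<lambda>_. 1))"

text \<open>The fractional ideal generated by \<open>f\<close> over the local ring of \<open>\<X>\<close> at \<open>x\<close>, in the function field.\<close>

definition stalk_ideal :: "('k::field, 'n::finite) point set \<Rightarrow> (('k, 'n) point \<Rightarrow> 'k) \<Rightarrow>
    ('k, 'n) point \<Rightarrow> (('k, 'n) point \<Rightarrow> 'k) set" where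
  "stalk_ideal \<X> f x = {h. \<exists>a. regular_at UNIV \<X> a x \<and> rat_eq \<X> h (\<lambda>z. a z * f z)}"

abbreviation local_ring :: "('k::field, 'n::finite) point set \<Rightarrow>
    ('k, 'n) point \<Rightarrow> (('k, 'n) point \<Rightarrow> 'k) set" where
  "local_ring \<X> \<equiv> stalk_ideal \<X> (\<lambda>_. 1)"

text \<open>
  A Cartier divisor \<open>D\<close> is given by the stalks of its ideal sheaf: if \<open>f\<close> is a local equation of \<open>D\<close>
  around \<open>x\<close>, then \<open>D x\<close> is the fractional ideal generated by \<open>f\<close> at \<open>x\<close>. On smooth varieties these are
  the same as Weil divisors.
\<close>

type_synonym ('k, 'n) divisor = "('k, 'n) point \<Rightarrow> (('k, 'n) point \<Rightarrow> 'k) set"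

definition cartier_divisor :: "('k::field, 'n::finite) point set \<Rightarrow> ('k, 'n) divisor \<Rightarrow> bool" where
  "cartier_divisor \<X> D \<longleftrightarrow> (\<forall>x. x \<notin> \<X> \<longrightarrow> D x = {}) \<and>
     (\<forall>x\<in>\<X>. \<exists>U f. openin (zariski UNIV \<X>) U \<and> x \<in> U \<and> invertible_rational \<X> f \<and>
        (\<forall>z\<in>U. D z = stalk_ideal \<X> f z))"

text \<open>The divisor \<open>D + div s\<close>.\<close>

definition add_principal :: "('k::field, 'n::finite) point set \<Rightarrow> ('k, 'n) divisor \<Rightarrow>
    (('k, 'n) point \<Rightarrow> 'k) \<Rightarrow> ('k, 'n) divisor" where
  "add_principal \<X> D s x = {h. \<exists>f\<in>D x. rat_eq \<X> h (\<lambda>z. s z * f z)}"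

text \<open>
  \<open>H\<^sup>0(\<X>, D)\<close>, as the rational functions \<open>s\<close> such that \<open>s = 0\<close> or \<open>D + div s\<close> is effective.
\<close>

definition global_sections :: "('k::field, 'n::finite) point set \<Rightarrow> ('k, 'n) divisor \<Rightarrow>
    (('k, 'n) point \<Rightarrow> 'k) set" where
  "global_sections \<X> D = {s. rational_function \<X> s \<and>
     (\<forall>x\<in>\<X>. \<forall>f\<in>D x. (\<lambda>z. s z * f z) \<in> local_ring \<X> x)}"

definition linear_system :: "('k::field, 'n::finite) point set \<Rightarrow> ('k, 'n) divisor set \<Rightarrow> bool" where
  "linear_system \<X> \<Gamma> \<longleftrightarrow> (\<exists>D V. cartier_divisor \<X> D \<and> V \<subseteq> global_sections \<X> D \<and>
     (\<lambda>_. 0) \<in> V \<and> (\<forall>s\<in>V. \<forall>t\<in>V. (\<lambda>z. s z + t z) \<in> V) \<and> (\<forall>c. \<forall>s\<in>V. (\<lambda>z. c * s z) \<in> V) \<and>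
     \<Gamma> = {add_principal \<X> D s | s. s \<in> V \<and> \<not> rat_eq \<X> s (\<lambda>_. 0)})"

text \<open>
  The support of an effective divisor is the zero locus of its ideal sheaf. An effective divisor, as
  a closed subscheme, contains a reduced closed point iff that point lies in its support.
\<close>

definition divisor_support :: "('k::field, 'n::finite) point set \<Rightarrow> ('k, 'n) divisor \<Rightarrow>
    ('k, 'n) point set" where
  "divisor_support \<X> H = {x \<in> \<X>. \<forall>f\<in>H x. regular_at UNIV \<X> f x \<longrightarrow> f x = 0}"

definition base_locus :: "('k::field, 'n::finite) point set \<Rightarrow> ('k, 'n) divisor set \<Rightarrow>
    ('k, 'n) point set" where
  "base_locus \<X> \<Gamma> = {x \<in> \<X>. \<forall>H\<in>\<Gamma>. x \<in> divisor_support \<X> H}"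

text \<open>\<open>\<Gamma> - P\<close>: the members of \<open>\<Gamma>\<close> that contain the finite set of points \<open>P\<close>.\<close>

definition subsystem_through :: "('k::field, 'n::finite) point set \<Rightarrow> ('k, 'n) divisor set \<Rightarrow>
    ('k, 'n) point set \<Rightarrow> ('k, 'n) divisor set" where
  "subsystem_through \<X> \<Gamma> P = {H \<in> \<Gamma>. P \<subseteq> divisor_support \<X> H}"

definition interpolating :: "('k::field, 'n::finite) point set \<Rightarrow> ('k, 'n) point set \<Rightarrow>
    ('k, 'n) divisor set \<Rightarrow> bool" where
  "interpolating \<X> P \<Gamma> \<longleftrightarrow> subsystem_through \<X> \<Gamma> P \<noteq> {} \<and>
     has_dim (subtopology (zariski UNIV \<X>) (base_locus \<X> (subsystem_through \<X> \<Gamma> P))) 0"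

text \<open>
  Pullback of an effective divisor: the stalk at \<open>y\<close> is the ideal generated by the pullbacks of the
  stalk at \<open>\<phi> y\<close>. The representative \<open>f\<close> has to be regular at \<open>\<phi> y\<close>, since it is the actual
  function near \<open>\<phi> y\<close> (not only its values on a dense open set) that is composed with \<open>\<phi>\<close>.
\<close>

definition pullback_divisor :: "('k::field, 'm::finite) point set \<Rightarrow> ('k, 'n::finite) point set \<Rightarrow>
    (('k, 'm) point \<Rightarrow> ('k, 'n) point) \<Rightarrow> ('k, 'n) divisor \<Rightarrow> ('k, 'm) divisor" where
  "pullback_divisor \<Y> \<X> \<phi> H y = (if y \<in> \<Y>
     then {h. \<exists>f\<in>H (\<phi> y). regular_at UNIV \<X> f (\<phi> y) \<and>
            (\<exists>a. regular_at UNIV \<Y> a y \<and> rat_eq \<Y> h (\<lambda>z. a z * f (\<phi> z)))}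
     else {})"

definition pullback_system :: "('k::field, 'm::finite) point set \<Rightarrow> ('k, 'n::finite) point set \<Rightarrow>
    (('k, 'm) point \<Rightarrow> ('k, 'n) point) \<Rightarrow> ('k, 'n) divisor set \<Rightarrow> ('k, 'm) divisor set" where
  "pullback_system \<Y> \<X> \<phi> \<Gamma> = pullback_divisor \<Y> \<X> \<phi> ` \<Gamma>"

end

theory Submission
  imports Defs
begin

text \<open>
  The support of \<open>\<phi>\<^sup>*H\<close> is the preimage of the support of \<open>H\<close> (\<open>divisor_support_pullback\<close>). Hence
  \<open>\<phi>\<^sup>*H\<close> contains \<open>P\<^sub>0\<close> as soon as \<open>H\<close> contains \<open>P\<close>, so that \<open>\<phi>\<^sup>*\<Gamma> - P\<^sub>0\<close> contains the pullbacks of all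
  members of \<open>\<Gamma> - P\<close>: it is non-empty, and its base locus \<open>B'\<close> satisfies
  \<open>P\<^sub>0 \<subseteq> B' \<subseteq> \<phi>\<^sup>-\<^sup>1(B)\<close>, where \<open>B\<close> is the base locus of \<open>\<Gamma> - P\<close>.

  It remains to see that \<open>B'\<close> has dimension \<open>0\<close> like \<open>B\<close>. As \<open>B'\<close> contains \<open>P\<^sub>0\<close>, it has a closed point,
  so its dimension is at least \<open>0\<close>. Let \<open>Z\<close> be an irreducible subset of \<open>B'\<close>. The closure of \<open>\<phi>(Z)\<close> in \<open>B\<close>
  is irreducible, and points are closed; since \<open>B\<close> has no chain of length one, this closure is a point,
  so \<open>Z\<close> lies in a fibre of \<open>\<phi>\<close>. The fibres of a finite morphism are finite (\<open>finite_fibre\<close>), and a finite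
  irreducible set whose points are closed is itself a point. So \<open>B'\<close> has no chain of length one either
  (\<open>has_dim_0_finite_fibres\<close>). The argument is purely topological; in particular it does not pass
  through a decomposition of \<open>B\<close> into irreducible components.
\<close>

section \<open>Functions given by forms\<close>

text \<open>
  These closure properties suffice for the forms with coefficients in \<open>C\<close> to be stable under
  products and substitution, and they hold for both coefficient domains of interest, the base field
  and its algebraic closure.
\<close>

definition subsemiring :: "'k::comm_semiring_1 set \<Rightarrow> bool" where
  "subsemiring C \<longleftrightarrow> 0 \<in> C \<and> 1 \<in> C \<and> (\<forall>a\<in>C. \<forall>b\<in>C. a + b \<in> C \<and> a * b \<in> C)"

lemma subsemiring_UNIV: "subsemiring UNIV"
  by (simp add: subsemiring_def)

lemma subsemiring_base_field: "subsemiring (base_field :: 'a::field alg_closure set)"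
  unfolding subsemiring_def
proof (intro conjI ballI)
  show "(0 :: 'a alg_closure) \<in> base_field" "(1 :: 'a alg_closure) \<in> base_field"
    using to_ac_0 to_ac_1 by (metis rangeI)+
  fix a b :: "'a alg_closure" assume "a \<in> base_field" "b \<in> base_field"
  then obtain a' b' where "a = to_ac a'" "b = to_ac b'" by blast
  then show "a + b \<in> base_field" "a * b \<in> base_field"
    by (metis rangeI to_ac_add, metis rangeI to_ac_mult)
qed

text \<open>
  Regular functions and morphisms depend on forms only through their values, so products and
  substitutions are carried out on functions on \<open>K\<^sup>n\<close> instead of formal polynomials.
\<close>

definition form_fun :: "'k set \<Rightarrow> nat \<Rightarrow> ('k::field ^ 'n::finite \<Rightarrow> 'k) set" where
  "form_fun C d = (\<lambda>F v. eval_mpoly F (vec_nth v)) ` forms C d"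

lemma form_funI: "F \<in> forms C d \<Longrightarrow> (\<lambda>v. eval_mpoly F (vec_nth v)) \<in> form_fun C d"
  by (simp add: form_fun_def)

lemma forms_mono: "forms C d \<subseteq> forms UNIV d"
  by (auto simp: forms_def polys_over_def)

lemma eval_mpoly_superset:
  fixes p :: "('v::finite, 'k::field) mpoly"
  assumes "finite S" "Poly_Mapping.keys p \<subseteq> S"
  shows "eval_mpoly p v =
    (\<Sum>m\<in>S. Poly_Mapping.lookup p m * (\<Prod>i\<in>UNIV. v i ^ Poly_Mapping.lookup m i))"
proof -
  have mon: "(\<Prod>i\<in>Poly_Mapping.keys m. v i ^ Poly_Mapping.lookup m i)
      = (\<Prod>i\<in>UNIV. v i ^ Poly_Mapping.lookup m i)" for m :: "'v \<Rightarrow>\<^sub>0 nat"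
    by (rule prod.mono_neutral_left) (auto simp: in_keys_iff)
  show ?thesis
    unfolding eval_mpoly_def mon
    by (rule sum.mono_neutral_left) (use assms in \<open>auto simp: in_keys_iff\<close>)
qed

lemma degree_keys_UNIV:
  fixes m :: "'v::finite \<Rightarrow>\<^sub>0 nat"
  shows "(\<Sum>i\<in>Poly_Mapping.keys m. Poly_Mapping.lookup m i) = (\<Sum>i\<in>UNIV. Poly_Mapping.lookup m i)"
  by (rule sum.mono_neutral_left) (auto simp: in_keys_iff)

lemma eval_mpoly_add:
  fixes p q :: "('v::finite, 'k::field) mpoly"
  shows "eval_mpoly (p + q) v = eval_mpoly p v + eval_mpoly q v"
proof -
  let ?S = "Poly_Mapping.keys p \<union> Poly_Mapping.keys q"
  have "Poly_Mapping.keys (p + q) \<subseteq> ?S" by (rule keys_add)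
  then show ?thesis
    by (simp add: eval_mpoly_superset[of ?S] lookup_add ring_distribs sum.distrib)
qed

lemma form_fun_monomial:
  fixes m :: "'n::finite \<Rightarrow>\<^sub>0 nat"
  assumes "c \<in> C" "(\<Sum>i\<in>UNIV. Poly_Mapping.lookup m i) = d"
  shows "(\<lambda>v. c * (\<Prod>i\<in>UNIV. vec_nth v i ^ Poly_Mapping.lookup m i)) \<in> form_fun C d"
proof -
  have "Poly_Mapping.single m c \<in> forms C d"
    using assms by (auto simp: forms_def polys_over_def degree_keys_UNIV)
  moreover have "eval_mpoly (Poly_Mapping.single m c) (vec_nth v)
      = c * (\<Prod>i\<in>UNIV. vec_nth v i ^ Poly_Mapping.lookup m i)" for v
    by (subst eval_mpoly_superset[of "{m}"]) auto
  ultimately show ?thesis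
    using form_funI by fastforce
qed

lemma form_fun_zero: "(\<lambda>_. 0) \<in> form_fun C d"
proof -
  have "0 \<in> forms C d" by (simp add: forms_def polys_over_def)
  from form_funI[OF this] show ?thesis by (simp add: eval_mpoly_def)
qed

lemma form_fun_add:
  assumes C: "subsemiring C" and "f \<in> form_fun C d" "g \<in> form_fun C d"
  shows "(\<lambda>v. f v + g v) \<in> form_fun C d"
proof -
  obtain F G where F: "F \<in> forms C d" "f = (\<lambda>v. eval_mpoly F (vec_nth v))"
    and G: "G \<in> forms C d" "g = (\<lambda>v. eval_mpoly G (vec_nth v))"
    using assms by (auto simp: form_fun_def)
  have coeff: "Poly_Mapping.lookup H m \<in> C" if "H \<in> forms C d" for H m
    using that C unfolding forms_def polys_over_def subsemiring_def
    by (cases "m \<in> Poly_Mapping.keys H") (auto simp: in_keys_iff)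
  have "F + G \<in> forms C d"
    using F(1) G(1) keys_add[of F G] coeff[OF F(1)] coeff[OF G(1)] C
    by (auto simp: forms_def polys_over_def lookup_add subsemiring_def)
  from form_funI[OF this] show ?thesis
    by (simp add: F(2) G(2) eval_mpoly_add)
qed

lemma form_fun_sum:
  assumes "subsemiring C" "\<And>i. i \<in> I \<Longrightarrow> f i \<in> form_fun C d"
  shows "(\<lambda>v. \<Sum>i\<in>I. f i v) \<in> form_fun C d"
  using assms(2)
proof (induction I rule: infinite_finite_induct)
  case (insert i I)
  then show ?case using form_fun_add[OF assms(1), of "f i" d] by simp
qed (auto simp: form_fun_zero)

text \<open>
  Writing a form as an explicit sum of monomials of the same degree reduces products, substitution
  and homogeneity to the case of a monomial.
\<close>

lemma form_fun_expand:
  fixes f :: "'k::field ^ 'n::finite \<Rightarrow> 'k"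
  assumes "f \<in> form_fun C d"
  obtains M :: "('n \<Rightarrow>\<^sub>0 nat) set" and c where "finite M"
    "\<forall>m\<in>M. c m \<in> C \<and> (\<Sum>i\<in>UNIV. Poly_Mapping.lookup m i) = d"
    "f = (\<lambda>v. \<Sum>m\<in>M. c m * (\<Prod>i\<in>UNIV. vec_nth v i ^ Poly_Mapping.lookup m i))"
proof -
  obtain F where F: "F \<in> forms C d" "f = (\<lambda>v. eval_mpoly F (vec_nth v))"
    using assms by (auto simp: form_fun_def)
  show ?thesis
  proof (rule that[of "Poly_Mapping.keys F" "Poly_Mapping.lookup F"])
    show "f = (\<lambda>v. \<Sum>m\<in>Poly_Mapping.keys F. Poly_Mapping.lookup F m *
        (\<Prod>i\<in>UNIV. vec_nth v i ^ Poly_Mapping.lookup m i))"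
      unfolding F(2) by (subst eval_mpoly_superset[of "Poly_Mapping.keys F"]) auto
  qed (use F(1) in \<open>auto simp: forms_def polys_over_def degree_keys_UNIV\<close>)
qed

lemma form_fun_mult:
  fixes f g :: "'k::field ^ 'n::finite \<Rightarrow> 'k"
  assumes C: "subsemiring C" and f: "f \<in> form_fun C d" and g: "g \<in> form_fun C e"
  shows "(\<lambda>v. f v * g v) \<in> form_fun C (d + e)"
proof -
  obtain M :: "('n \<Rightarrow>\<^sub>0 nat) set" and c where M: "finite M"
    "\<forall>m\<in>M. c m \<in> C \<and> (\<Sum>i\<in>UNIV. Poly_Mapping.lookup m i) = d"
    "f = (\<lambda>v. \<Sum>m\<in>M. c m * (\<Prod>i\<in>UNIV. vec_nth v i ^ Poly_Mapping.lookup m i))"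
    using f by (rule form_fun_expand) (rule that)
  obtain M' :: "('n \<Rightarrow>\<^sub>0 nat) set" and c' where M': "finite M'"
    "\<forall>m\<in>M'. c' m \<in> C \<and> (\<Sum>i\<in>UNIV. Poly_Mapping.lookup m i) = e"
    "g = (\<lambda>v. \<Sum>m\<in>M'. c' m * (\<Prod>i\<in>UNIV. vec_nth v i ^ Poly_Mapping.lookup m i))"
    using g by (rule form_fun_expand) (rule that)
  have eq: "(\<lambda>v. f v * g v) = (\<lambda>v. \<Sum>m\<in>M. \<Sum>m'\<in>M'. (c m * c' m') *
      (\<Prod>i\<in>UNIV. vec_nth v i ^ Poly_Mapping.lookup (m + m') i))"
    unfolding M(3) M'(3)
    unfolding sum_product lookup_add power_add prod.distrib
    by (intro ext sum.cong refl) (simp only: mult_ac)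
  show ?thesis
    unfolding eq
  proof (intro form_fun_sum[OF C] form_fun_monomial)
    fix m m' assume m: "m \<in> M" "m' \<in> M'"
    show "c m * c' m' \<in> C" using bspec[OF M(2) m(1)] bspec[OF M'(2) m(2)] C by (auto simp: subsemiring_def)
    show "(\<Sum>i\<in>UNIV. Poly_Mapping.lookup (m + m') i) = d + e"
      using bspec[OF M(2) m(1)] bspec[OF M'(2) m(2)] by (simp add: lookup_add sum.distrib)
  qed
qed

lemma form_fun_const:
  fixes C :: "'k::field set"
  shows "c \<in> C \<Longrightarrow> (\<lambda>_::'k^'n::finite. c) \<in> form_fun C 0"
  using form_fun_monomial[of c C "0 :: 'n \<Rightarrow>\<^sub>0 nat" 0] by simp

lemma form_fun_coordinate:
  fixes C :: "'k::field set" and i :: "'n::finite"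
  assumes "1 \<in> C"
  shows "(\<lambda>v. vec_nth v i) \<in> form_fun C 1"
proof -
  let ?m = "Poly_Mapping.single i (1::nat)"
  have "(\<Prod>j\<in>UNIV. vec_nth v j ^ Poly_Mapping.lookup ?m j) = vec_nth v i" for v :: "'k^'n"
    by (subst prod.remove[of UNIV i]) (auto simp: lookup_single)
  moreover have "(\<Sum>j\<in>UNIV. Poly_Mapping.lookup ?m j) = 1"
    by (subst sum.remove[of UNIV i]) (auto simp: lookup_single)
  ultimately show ?thesis
    using form_fun_monomial[OF assms, of ?m 1] by simp
qed

lemma form_fun_power:
  assumes C: "subsemiring C" and f: "f \<in> form_fun C d"
  shows "(\<lambda>v. f v ^ k) \<in> form_fun C (k * d)"
proof (induction k)
  case 0
  show ?case using form_fun_const[of 1 C] C by (simp add: subsemiring_def)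
next
  case (Suc k)
  from form_fun_mult[OF C f this] show ?case by simp
qed

lemma form_fun_prod:
  assumes C: "subsemiring C" and "finite I" and "\<And>i. i \<in> I \<Longrightarrow> f i \<in> form_fun C (d i)"
  shows "(\<lambda>v. \<Prod>i\<in>I. f i v) \<in> form_fun C (\<Sum>i\<in>I. d i)"
  using assms(2,3)
proof (induction I rule: finite_induct)
  case empty
  show ?case using form_fun_const[of 1 C] C by (simp add: subsemiring_def)
next
  case (insert i I)
  then show ?case using form_fun_mult[OF C, of "f i" "d i"] by simp
qed

lemma form_fun_diff:
  assumes "f \<in> form_fun UNIV d" "g \<in> form_fun UNIV d"
  shows "(\<lambda>v. f v - g v) \<in> form_fun UNIV d"
proof -
  have "(\<lambda>v. (- 1) * g v) \<in> form_fun UNIV (0 + d)"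
    by (intro form_fun_mult form_fun_const subsemiring_UNIV assms) simp
  then have "(\<lambda>v. f v + (- 1) * g v) \<in> form_fun UNIV d"
    using assms by (intro form_fun_add) (auto simp: subsemiring_UNIV)
  then show ?thesis by simp
qed

text \<open>
  Substituting forms of degree \<open>e\<close> into a monomial of degree \<open>d\<close> gives a product of \<open>d\<close> forms of
  degree \<open>e\<close>. This is what makes morphisms continuous and regular functions pull back to regular
  functions.
\<close>

lemma form_fun_compose:
  fixes f :: "'k::field ^ 'n::finite \<Rightarrow> 'k" and g :: "'n \<Rightarrow> 'k ^ 'm::finite \<Rightarrow> 'k"
  assumes C: "subsemiring C" and f: "f \<in> form_fun C d" and g: "\<And>i. g i \<in> form_fun C e"
  shows "(\<lambda>v. f (\<chi> i. g i v)) \<in> form_fun C (d * e)"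
proof -
  obtain M :: "('n \<Rightarrow>\<^sub>0 nat) set" and c where M: "finite M"
    "\<forall>m\<in>M. c m \<in> C \<and> (\<Sum>i\<in>UNIV. Poly_Mapping.lookup m i) = d"
    "f = (\<lambda>v. \<Sum>m\<in>M. c m * (\<Prod>i\<in>UNIV. vec_nth v i ^ Poly_Mapping.lookup m i))"
    using f by (rule form_fun_expand) (rule that)
  show ?thesis
    unfolding M(3) vec_lambda_beta
  proof (rule form_fun_sum[OF C])
    fix m assume m: "m \<in> M"
    have "(\<lambda>v. c m * (\<Prod>i\<in>UNIV. g i v ^ Poly_Mapping.lookup m i))
        \<in> form_fun C (0 + (\<Sum>i\<in>UNIV. Poly_Mapping.lookup m i * e))"
      using bspec[OF M(2) m]
      by (intro form_fun_mult[OF C] form_fun_const form_fun_prod[OF C] form_fun_power[OF C] g) auto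
    then show "(\<lambda>v. c m * (\<Prod>i\<in>UNIV. g i v ^ Poly_Mapping.lookup m i)) \<in> form_fun C (d * e)"
      using bspec[OF M(2) m] by (simp add: sum_distrib_right[symmetric])
  qed
qed

lemma form_fun_scale:
  fixes f :: "'k::field ^ 'n::finite \<Rightarrow> 'k"
  assumes "f \<in> form_fun C d"
  shows "f (a *s v) = a ^ d * f v"
proof -
  obtain M :: "('n \<Rightarrow>\<^sub>0 nat) set" and c where M: "finite M"
    "\<forall>m\<in>M. c m \<in> C \<and> (\<Sum>i\<in>UNIV. Poly_Mapping.lookup m i) = d"
    "f = (\<lambda>v. \<Sum>m\<in>M. c m * (\<Prod>i\<in>UNIV. vec_nth v i ^ Poly_Mapping.lookup m i))"
    using assms by (rule form_fun_expand) (rule that)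
  show ?thesis
    unfolding M(3) sum_distrib_left
  proof (rule sum.cong[OF refl])
    fix m assume "m \<in> M"
    then have d: "(\<Sum>i\<in>UNIV. Poly_Mapping.lookup m i) = d" using M(2) by blast
    show "c m * (\<Prod>i\<in>UNIV. vec_nth (a *s v) i ^ Poly_Mapping.lookup m i)
        = a ^ d * (c m * (\<Prod>i\<in>UNIV. vec_nth v i ^ Poly_Mapping.lookup m i))"
      by (simp add: power_mult_distrib prod.distrib power_sum[symmetric] d)
  qed
qed

section \<open>The Zariski topology\<close>

lemma mem_line_of: "v \<in> line_of v"
  unfolding line_of_def by (rule CollectI, rule exI[of _ 1]) simp

lemma proj_space_nonempty: "x \<in> proj_space \<Longrightarrow> \<exists>v. v \<in> x"
  using mem_line_of by (auto simp: proj_space_def)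

lemma proj_space_scale:
  assumes "x \<in> proj_space" "v \<in> x" "w \<in> x"
  shows "\<exists>a. a \<noteq> 0 \<and> w = a *s v"
proof -
  obtain u b c where "v = b *s u" "w = c *s u" "b \<noteq> 0" "c \<noteq> 0"
    using assms by (auto simp: proj_space_def line_of_def)
  then show ?thesis
    by (intro exI[of _ "c / b"]) (auto simp: vector_smult_assoc)
qed

lemma form_fun_zero_on_point:
  assumes "f \<in> form_fun C d" "x \<in> proj_space" "v \<in> x" "w \<in> x"
  shows "f v = 0 \<longleftrightarrow> f w = 0"
  using proj_space_scale[OF assms(2-4)] form_fun_scale[OF assms(1)] by auto

lemma projective_over_proj_space: "projective_over C \<X> \<Longrightarrow> \<X> \<subseteq> proj_space"
  by (auto simp: projective_over_def)

lemma openin_nonvanishing: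
  assumes "f \<in> form_fun C d"
  shows "openin (zariski C \<X>) {x \<in> \<X>. \<forall>v\<in>x. f v \<noteq> 0}"
  using assms unfolding zariski_def form_fun_def
  by (intro topology_generated_by_Basis) auto

lemma topspace_zariski:
  assumes "subsemiring C" shows "topspace (zariski C \<X>) = \<X>"
proof -
  have "(\<lambda>_. 1) \<in> form_fun C 0" using assms by (auto simp: subsemiring_def intro: form_fun_const)
  from openin_subset[OF openin_nonvanishing[OF this, of \<X>]] show ?thesis
    by (auto simp: zariski_def topology_generated_by_topspace)
qed

lemma openin_zariski_UNIV:
  fixes C :: "'k::field set"
  assumes "openin (zariski C \<X>) W"
  shows "openin (zariski UNIV \<X>) W"
proof -
  define S where "S C' = {{x \<in> \<X>. \<forall>v\<in>x. eval_mpoly F (vec_nth v) \<noteq> 0} | F. F \<in> (\<Union>d. forms C' d)}"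
    for C' :: "'k set"
  have sub: "S C \<subseteq> S UNIV" using forms_mono unfolding S_def by blast
  have "generate_topology_on (S C) W"
    using assms by (simp add: zariski_def openin_topology_generated_by_iff S_def)
  moreover have "generate_topology_on (S UNIV) V" if "V \<in> S C" for V
    using that sub by (blast intro: generate_topology_on.Basis)
  ultimately have "generate_topology_on (S UNIV) W"
    by (rule generate_topology_on_coarsest[OF istopology_generate_topology_on, rotated])
  then show ?thesis by (simp add: zariski_def openin_topology_generated_by_iff S_def)
qed

text \<open>
  Two points are equal iff all \<open>2 \<times> 2\<close> minors of their coordinate vectors \<open>v\<close> and \<open>w\<close> vanish, and with
  \<open>w\<close> fixed each minor is a linear form in \<open>v\<close>.
\<close>

lemma t1_space_zariski:
  assumes \<X>: "\<X> \<subseteq> (proj_space :: ('k::field, 'n::finite) point set)"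
  shows "t1_space (zariski UNIV \<X>)"
  unfolding t1_space_def topspace_zariski[OF subsemiring_UNIV]
proof (intro ballI impI)
  fix x y assume x: "x \<in> \<X>" and y: "y \<in> \<X>" and neq: "x \<noteq> y"
  have "x \<in> proj_space" "y \<in> proj_space" using \<X> x y by auto
  then obtain v w where v: "x = line_of v" "v \<noteq> 0" and w: "y = line_of w" "w \<noteq> 0"
    unfolding proj_space_def by blast
  have "\<exists>i j. vec_nth v i * vec_nth w j \<noteq> vec_nth v j * vec_nth w i"
  proof (rule ccontr)
    assume "\<not> ?thesis"
    then have eq: "vec_nth v i * vec_nth w j = vec_nth v j * vec_nth w i" for i j by blast
    obtain j where j: "vec_nth w j \<noteq> 0" using w(2) by (auto simp: vec_eq_iff)
    define c where "c = vec_nth v j / vec_nth w j"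
    have vw: "v = c *s w"
      using eq[of _ j] j by (simp add: vec_eq_iff c_def field_simps)
    then have c: "c \<noteq> 0" using v(2) by auto
    have "u \<in> line_of v \<longleftrightarrow> u \<in> line_of w" for u
    proof
      assume "u \<in> line_of v"
      then obtain a where "a \<noteq> 0" "u = a *s v" by (auto simp: line_of_def)
      then show "u \<in> line_of w"
        using c vw by (auto simp: line_of_def vector_smult_assoc intro!: exI[of _ "a * c"])
    next
      assume "u \<in> line_of w"
      then obtain a where "a \<noteq> 0" "u = a *s w" by (auto simp: line_of_def)
      then show "u \<in> line_of v"
        using c vw by (auto simp: line_of_def vector_smult_assoc intro!: exI[of _ "a / c"])
    qed
    then show False using neq v(1) w(1) by blast
  qed
  then obtain i j where ij: "vec_nth v i * vec_nth w j \<noteq> vec_nth v j * vec_nth w i" by blast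
  define f where "f = (\<lambda>u. vec_nth u i * vec_nth w j - vec_nth u j * vec_nth w i)"
  have "(\<lambda>u. vec_nth u i * a) \<in> form_fun UNIV (1 + 0)" for i and a :: 'k
    by (intro form_fun_mult form_fun_coordinate form_fun_const) (auto simp: subsemiring_UNIV)
  then have f: "f \<in> form_fun UNIV 1"
    unfolding f_def by (intro form_fun_diff) simp_all
  have "f v \<noteq> 0" "f w = 0" using ij by (simp_all add: f_def mult.commute)
  then have "x \<in> {x \<in> \<X>. \<forall>v\<in>x. f v \<noteq> 0}" "y \<notin> {x \<in> \<X>. \<forall>v\<in>x. f v \<noteq> 0}"
    using x y \<X> v(1) w(1) mem_line_of form_fun_zero_on_point[OF f] by blast+
  then show "\<exists>U. openin (zariski UNIV \<X>) U \<and> x \<in> U \<and> y \<notin> U"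
    using openin_nonvanishing[OF f] by blast
qed

lemma dense_open_whole: "dense_open \<X> \<X>"
  unfolding dense_open_def
  by (metis closure_of_topspace openin_topspace subsemiring_UNIV topspace_zariski)

lemma rat_eq_refl: "rat_eq \<X> f f"
  using dense_open_whole by (auto simp: rat_eq_def)

section \<open>Regular functions\<close>

lemma regular_atE:
  assumes "regular_at C \<X> f x"
  obtains d p q W where "p \<in> form_fun C d" "q \<in> form_fun C d" "openin (zariski C \<X>) W" "x \<in> W"
    "\<And>z v. z \<in> W \<Longrightarrow> v \<in> z \<Longrightarrow> q v \<noteq> 0 \<and> f z = p v / q v"
proof -
  obtain d F G W where "F \<in> forms C d" "G \<in> forms C d" "openin (zariski C \<X>) W" "x \<in> W"
    "\<forall>z\<in>W. \<forall>v\<in>z. eval_mpoly G (vec_nth v) \<noteq> 0 \<and> f z = eval_mpoly F (vec_nth v) / eval_mpoly G (vec_nth v)"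
    using assms unfolding regular_at_def by blast
  then show ?thesis
    by (intro that[of "\<lambda>v. eval_mpoly F (vec_nth v)" d "\<lambda>v. eval_mpoly G (vec_nth v)" W] form_funI) auto
qed

lemma regular_atI:
  assumes "p \<in> form_fun C d" "q \<in> form_fun C d" "openin (zariski C \<X>) W" "x \<in> W"
    and "\<And>z v. z \<in> W \<Longrightarrow> v \<in> z \<Longrightarrow> q v \<noteq> 0 \<and> f z = p v / q v"
  shows "regular_at C \<X> f x"
  using assms unfolding regular_at_def form_fun_def by blast

lemma regular_at_const:
  assumes "subsemiring C" "c \<in> C" "x \<in> \<X>"
  shows "regular_at C \<X> (\<lambda>_. c) x"
proof (rule regular_atI)
  show "openin (zariski C \<X>) \<X>" using topspace_zariski[OF assms(1)] openin_topspace by metis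
  show "(\<lambda>_. c) \<in> form_fun C 0" "(\<lambda>_. 1) \<in> form_fun C 0"
    using assms by (auto simp: subsemiring_def intro!: form_fun_const)
qed (use assms in auto)

lemma regular_at_mult:
  assumes C: "subsemiring C" and f: "regular_at C \<X> f x" and g: "regular_at C \<X> g x"
  shows "regular_at C \<X> (\<lambda>z. f z * g z) x"
proof -
  obtain d p q W where f: "p \<in> form_fun C d" "q \<in> form_fun C d" "openin (zariski C \<X>) W" "x \<in> W"
    "\<And>z v. z \<in> W \<Longrightarrow> v \<in> z \<Longrightarrow> q v \<noteq> 0 \<and> f z = p v / q v"
    using f by (rule regular_atE) blast
  obtain d' p' q' W' where g: "p' \<in> form_fun C d'" "q' \<in> form_fun C d'"
    "openin (zariski C \<X>) W'" "x \<in> W'"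
    "\<And>z v. z \<in> W' \<Longrightarrow> v \<in> z \<Longrightarrow> q' v \<noteq> 0 \<and> g z = p' v / q' v"
    using g by (rule regular_atE) blast
  show ?thesis
  proof (rule regular_atI)
    show "(\<lambda>v. p v * p' v) \<in> form_fun C (d + d')" "(\<lambda>v. q v * q' v) \<in> form_fun C (d + d')"
      by (intro form_fun_mult C f g)+
    show "openin (zariski C \<X>) (W \<inter> W')" "x \<in> W \<inter> W'" using f g by auto
    show "q v * q' v \<noteq> 0 \<and> f z * g z = p v * p' v / (q v * q' v)" if "z \<in> W \<inter> W'" "v \<in> z" for z v
      using f(5)[of z v] g(5)[of z v] that by auto
  qed
qed

lemma regular_on_power:
  assumes "subsemiring C" "U \<subseteq> \<X>" "f \<in> regular_on C \<X> U"
  shows "(\<lambda>z. f z ^ k) \<in> regular_on C \<X> U"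
proof (induction k)
  case 0
  then show ?case
    using assms regular_at_const[of C 1] by (auto simp: regular_on_def subsemiring_def)
next
  case (Suc k)
  then show ?case using assms regular_at_mult[of C \<X> f] by (auto simp: regular_on_def)
qed

text \<open>
  Where both functions are given by fractions, their difference has the numerator
  \<open>p q' - q p'\<close>, so they differ on an open set. If that set contained \<open>x\<close>, it would be non-empty and
  therefore meet the dense open set on which the functions agree.
\<close>

lemma regular_at_eqI:
  assumes \<X>: "\<X> \<subseteq> proj_space" and f: "regular_at UNIV \<X> f x" and g: "regular_at UNIV \<X> g x"
    and eq: "rat_eq \<X> f g"
  shows "f x = g x"
proof (rule ccontr)
  assume neq: "f x \<noteq> g x"
  obtain d p q W where f: "p \<in> form_fun UNIV d" "q \<in> form_fun UNIV d"
    "openin (zariski UNIV \<X>) W" "x \<in> W"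
    "\<And>z v. z \<in> W \<Longrightarrow> v \<in> z \<Longrightarrow> q v \<noteq> 0 \<and> f z = p v / q v"
    using f by (rule regular_atE) blast
  obtain d' p' q' W' where g: "p' \<in> form_fun UNIV d'" "q' \<in> form_fun UNIV d'"
    "openin (zariski UNIV \<X>) W'" "x \<in> W'"
    "\<And>z v. z \<in> W' \<Longrightarrow> v \<in> z \<Longrightarrow> q' v \<noteq> 0 \<and> g z = p' v / q' v"
    using g by (rule regular_atE) blast
  obtain U where U: "zariski UNIV \<X> closure_of U = \<X>" "\<And>z. z \<in> U \<Longrightarrow> f z = g z"
    using eq by (auto simp: rat_eq_def dense_open_def)
  define h where "h = (\<lambda>v. p v * q' v - q v * p' v)"
  have "h \<in> form_fun UNIV (d + d')"
    unfolding h_def by (intro form_fun_diff form_fun_mult subsemiring_UNIV f g)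
  from openin_nonvanishing[OF this] have
    "openin (zariski UNIV \<X>) ({z \<in> \<X>. \<forall>v\<in>z. h v \<noteq> 0} \<inter> (W \<inter> W'))" (is "openin _ ?N")
    using f(3) g(3) by blast
  moreover have h: "h v = 0 \<longleftrightarrow> f z = g z" if "z \<in> W" "z \<in> W'" "v \<in> z" for z v
    using f(5)[OF that(1,3)] g(5)[OF that(2,3)] by (auto simp: h_def field_simps)
  have x: "x \<in> \<X>" using f(3,4) openin_subset topspace_zariski[OF subsemiring_UNIV] by blast
  then have "x \<in> ?N" using f(4) g(4) h neq by blast
  moreover have "\<forall>T. x \<in> T \<and> openin (zariski UNIV \<X>) T \<longrightarrow> (\<exists>z. z \<in> U \<and> z \<in> T)"
    using U(1) x by (metis in_closure_of)
  ultimately obtain z where z: "z \<in> U" "z \<in> ?N"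
    by meson
  then obtain v where "v \<in> z" using \<X> proj_space_nonempty by blast
  then show False using z h U(2) by blast
qed

section \<open>Morphisms\<close>

text \<open>
  The local description by forms over \<open>C\<close> is read over the algebraic closure, where the topology is
  finer and more coefficients are available.
\<close>

lemma morphismE:
  assumes "morphism C \<Y> \<X> \<phi>" "y \<in> \<Y>"
  obtains d g W where "\<And>i. g i \<in> form_fun UNIV d" "openin (zariski UNIV \<Y>) W" "y \<in> W"
    "\<And>z v. z \<in> W \<Longrightarrow> v \<in> z \<Longrightarrow> (\<chi> i. g i v) \<in> \<phi> z"
proof -
  have "\<exists>d F W. (\<forall>i. F i \<in> forms C d) \<and> openin (zariski C \<Y>) W \<and> y \<in> W \<and>
      (\<forall>z\<in>W. \<forall>v\<in>z. (\<chi> i. eval_mpoly (F i) (vec_nth v)) \<in> \<phi> z)"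
    using assms unfolding morphism_def by simp
  then obtain d F W where F: "\<forall>i. F i \<in> forms C d" and W: "openin (zariski C \<Y>) W" "y \<in> W"
    and \<phi>: "\<forall>z\<in>W. \<forall>v\<in>z. (\<chi> i. eval_mpoly (F i) (vec_nth v)) \<in> \<phi> z"
    by - (elim exE conjE, rule that)
  show ?thesis
  proof (rule that[of "\<lambda>i v. eval_mpoly (F i) (vec_nth v)" d W])
    show "(\<lambda>v. eval_mpoly (F i) (vec_nth v)) \<in> form_fun UNIV d" for i
      using F forms_mono by (intro form_funI) auto
    show "openin (zariski UNIV \<Y>) W" by (rule openin_zariski_UNIV[OF W(1)])
  qed (use W(2) \<phi> in auto)
qed

text \<open>
  Locally \<open>\<phi> = [g\<^sub>0 : \<dots> : g\<^sub>n]\<close>, and there the preimage of the locus \<open>f \<noteq> 0\<close> is the locus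
  \<open>f(g\<^sub>0, \<dots>, g\<^sub>n) \<noteq> 0\<close>.
\<close>

lemma continuous_map_morphism:
  assumes \<X>: "\<X> \<subseteq> proj_space" and \<Y>: "\<Y> \<subseteq> proj_space" and \<phi>: "morphism C \<Y> \<X> \<phi>"
  shows "continuous_map (zariski UNIV \<Y>) (zariski UNIV \<X>) \<phi>"
proof -
  note top = topspace_zariski[OF subsemiring_UNIV]
  have range: "\<phi> ` \<Y> \<subseteq> \<X>" using \<phi> by (simp add: morphism_def)
  show ?thesis
    unfolding zariski_def[of UNIV \<X>]
  proof (rule continuous_on_generated_topo; (unfold top)?)
    show "\<phi> ` \<Y> \<subseteq> \<Union> {{x \<in> \<X>. \<forall>v\<in>x. eval_mpoly F (vec_nth v) \<noteq> 0} |F. F \<in> \<Union> (range (forms UNIV))}"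
      using range top[of \<X>] by (simp add: zariski_def topology_generated_by_topspace)
    fix U assume "U \<in> {{x \<in> \<X>. \<forall>v\<in>x. eval_mpoly F (vec_nth v) \<noteq> 0} |F. F \<in> \<Union> (range (forms UNIV))}"
    then obtain d f where f: "f \<in> form_fun UNIV d" and U: "U = {x \<in> \<X>. \<forall>v\<in>x. f v \<noteq> 0}"
      using form_funI by fastforce
    show "openin (zariski UNIV \<Y>) (\<phi> -` U \<inter> \<Y>)"
      unfolding openin_subopen[of _ "\<phi> -` U \<inter> \<Y>"]
    proof
      fix y assume y: "y \<in> \<phi> -` U \<inter> \<Y>"
      then have "y \<in> \<Y>" by blast
      then obtain e g W where g: "\<And>i. g i \<in> form_fun UNIV e" "openin (zariski UNIV \<Y>) W" "y \<in> W"
        "\<And>z v. z \<in> W \<Longrightarrow> v \<in> z \<Longrightarrow> (\<chi> i. g i v) \<in> \<phi> z"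
        by (rule morphismE[OF \<phi>]) blast
      let ?h = "\<lambda>v. f (\<chi> i. g i v)"
      let ?N = "{z \<in> \<Y>. \<forall>v\<in>z. ?h v \<noteq> 0} \<inter> W"
      have "?h \<in> form_fun UNIV (d * e)" by (intro form_fun_compose subsemiring_UNIV f g)
      then have "openin (zariski UNIV \<Y>) ?N" using openin_nonvanishing g(2) by blast
      moreover have "y \<in> ?N" using y g(3,4) U by auto
      moreover have "?N \<subseteq> \<phi> -` U \<inter> \<Y>"
      proof
        fix z assume z: "z \<in> ?N"
        then obtain v where v: "v \<in> z" using \<Y> proj_space_nonempty by blast
        have "\<phi> z \<in> \<X>" using z range by auto
        moreover have "f w \<noteq> 0" if "w \<in> \<phi> z" for w
          using form_fun_zero_on_point[OF f _ that g(4)[OF _ v]] \<open>\<phi> z \<in> \<X>\<close> \<X> z v by auto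
        ultimately show "z \<in> \<phi> -` U \<inter> \<Y>" using z U by auto
      qed
      ultimately show "\<exists>T. openin (zariski UNIV \<Y>) T \<and> y \<in> T \<and> T \<subseteq> \<phi> -` U \<inter> \<Y>" by blast
    qed
  qed
qed

lemma regular_at_pullback:
  assumes \<X>: "\<X> \<subseteq> proj_space" and \<Y>: "\<Y> \<subseteq> proj_space" and \<phi>: "morphism C \<Y> \<X> \<phi>"
    and y: "y \<in> \<Y>" and f: "regular_at UNIV \<X> f (\<phi> y)"
  shows "regular_at UNIV \<Y> (\<lambda>z. f (\<phi> z)) y"
proof -
  obtain d p q W where f: "p \<in> form_fun UNIV d" "q \<in> form_fun UNIV d"
    "openin (zariski UNIV \<X>) W" "\<phi> y \<in> W"
    "\<And>z v. z \<in> W \<Longrightarrow> v \<in> z \<Longrightarrow> q v \<noteq> 0 \<and> f z = p v / q v"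
    using f by (rule regular_atE) blast
  obtain e g W' where g: "\<And>i. g i \<in> form_fun UNIV e" "openin (zariski UNIV \<Y>) W'" "y \<in> W'"
    "\<And>z v. z \<in> W' \<Longrightarrow> v \<in> z \<Longrightarrow> (\<chi> i. g i v) \<in> \<phi> z"
    by (rule morphismE[OF \<phi> y]) blast
  have "openin (zariski UNIV \<Y>) {z \<in> \<Y>. \<phi> z \<in> W}"
    using openin_continuous_map_preimage[OF continuous_map_morphism[OF \<X> \<Y> \<phi>] f(3)]
    by (simp add: topspace_zariski[OF subsemiring_UNIV])
  then have W: "openin (zariski UNIV \<Y>) ({z \<in> \<Y>. \<phi> z \<in> W} \<inter> W')" using g(2) by blast
  show ?thesis
  proof (rule regular_atI[OF _ _ W])
    show "(\<lambda>v. p (\<chi> i. g i v)) \<in> form_fun UNIV (d * e)" "(\<lambda>v. q (\<chi> i. g i v)) \<in> form_fun UNIV (d * e)"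
      by (intro form_fun_compose subsemiring_UNIV f g)+
  qed (use y f(4,5) g(3,4) in auto)
qed

section \<open>Fibres of finite morphisms\<close>

text \<open>
  A homogeneous system of linear equations with fewer equations than unknowns has a non-zero
  solution, by Gaussian elimination.
\<close>

lemma nontrivial_linear_relation:
  fixes a :: "nat \<Rightarrow> 'b \<Rightarrow> 'k::field"
  assumes "finite B" "finite I" "card B < card I"
  shows "\<exists>c. (\<exists>k\<in>I. c k \<noteq> 0) \<and> (\<forall>g\<in>B. (\<Sum>k\<in>I. c k * a k g) = 0)"
  using assms
proof (induction B arbitrary: a I rule: finite_induct)
  case empty
  then have "I \<noteq> {}" by auto
  then show ?case by (intro exI[of _ "\<lambda>_. 1"]) auto
next
  case (insert b B)
  show ?case
  proof (cases "\<forall>k\<in>I. a k b = 0")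
    case True
    have "card B < card I" using insert by simp
    then obtain c where "\<exists>k\<in>I. c k \<noteq> 0" "\<forall>g\<in>B. (\<Sum>k\<in>I. c k * a k g) = 0"
      using insert.IH[of I a] insert.prems by blast
    then show ?thesis using True by auto
  next
    case False
    then obtain l where l: "l \<in> I" "a l b \<noteq> 0" by blast
    \<comment> \<open>Solve the equation of \<open>b\<close> for the unknown with index \<open>l\<close>; \<open>a'\<close> is the system that remains.\<close>
    define a' where "a' k g = a k g - a k b / a l b * a l g" for k g
    have "card B < card (I - {l})" using insert l by simp
    then obtain c where c: "\<exists>k\<in>I - {l}. c k \<noteq> 0" "\<forall>g\<in>B. (\<Sum>k\<in>I - {l}. c k * a' k g) = 0"
      using insert.IH[of "I - {l}" a'] insert.prems by blast
    define c' where "c' = c(l := - (\<Sum>k\<in>I - {l}. c k * (a k b / a l b)))"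
    have rel: "(\<Sum>k\<in>I. c' k * a k g) = (\<Sum>k\<in>I - {l}. c k * a' k g)" for g
    proof -
      have "(\<Sum>k\<in>I. c' k * a k g) = c' l * a l g + (\<Sum>k\<in>I - {l}. c' k * a k g)"
        using insert.prems l by (simp add: sum.remove)
      also have "(\<Sum>k\<in>I - {l}. c' k * a k g) = (\<Sum>k\<in>I - {l}. c k * a k g)"
        by (rule sum.cong) (auto simp: c'_def)
      also have "c' l * a l g = - (\<Sum>k\<in>I - {l}. c k * (a k b / a l b * a l g))"
        by (simp add: c'_def sum_distrib_right mult.assoc)
      finally show ?thesis
        by (simp add: a'_def right_diff_distrib sum_subtractf)
    qed
    have "a' k b = 0" for k using l by (simp add: a'_def)
    then have "(\<Sum>k\<in>I. c' k * a k g) = 0" if "g \<in> insert b B" for g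
      using that c(2) by (auto simp: rel)
    moreover have "\<exists>k\<in>I. c' k \<noteq> 0" using c(1) by (auto simp: c'_def)
    ultimately show ?thesis by blast
  qed
qed

text \<open>
  The powers \<open>f\<^sup>0, \<dots>, f\<^sup>n\<close> with \<open>n = card B\<close> lie in a space of functions on \<open>F\<close> spanned by \<open>n\<close> elements.
  So they satisfy a linear relation, which says that the values of \<open>f\<close> on \<open>F\<close> are roots of one non-zero
  polynomial.
\<close>

lemma finite_if_powers_in_span:
  fixes f :: "'p \<Rightarrow> 'k::field"
  assumes "finite B" and span: "\<And>k. \<exists>a. \<forall>y\<in>F. f y ^ k = (\<Sum>g\<in>B. a g * g y)"
  shows "finite (f ` F)"
proof -
  obtain a where a: "\<And>k y. y \<in> F \<Longrightarrow> f y ^ k = (\<Sum>g\<in>B. a k g * g y)" using span by metis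
  let ?n = "card B"
  obtain c where c: "\<exists>k\<in>{..?n}. c k \<noteq> 0" "\<forall>g\<in>B. (\<Sum>k\<le>?n. c k * a k g) = 0"
    using nontrivial_linear_relation[of B "{..?n}" a] assms(1) by auto
  define r where "r = (\<Sum>k\<le>?n. Polynomial.monom (c k) k)"
  have "Polynomial.coeff r k = c k" if "k \<le> ?n" for k
    using that by (simp add: r_def coeff_sum)
  then have "r \<noteq> 0" using c(1) by auto
  have "poly r (f y) = 0" if "y \<in> F" for y
  proof -
    have "poly r (f y) = (\<Sum>k\<le>?n. c k * (\<Sum>g\<in>B. a k g * g y))"
      using that by (simp add: r_def poly_sum poly_monom a)
    also have "\<dots> = (\<Sum>g\<in>B. (\<Sum>k\<le>?n. c k * a k g) * g y)"
      by (simp add: sum_distrib_left sum_distrib_right mult.assoc) (rule sum.swap)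
    finally show ?thesis using c(2) by simp
  qed
  then have "f ` F \<subseteq> {t. poly r t = 0}" by auto
  then show ?thesis using poly_roots_finite[OF \<open>r \<noteq> 0\<close>] finite_subset by blast
qed

text \<open>
  Over an affine neighbourhood of \<open>x\<close> the functions on the preimage \<open>V\<close> are generated as a module by
  finitely many \<open>g\<close>, with coefficients pulled back from \<open>\<X>\<close>. Those coefficients are constant on the
  fibre over \<open>x\<close>, so the restrictions to the fibre of all functions on \<open>V\<close>, and in particular of the
  powers of an affine coordinate, lie in the span of the \<open>g\<close>. Hence each affine coordinate takes
  finitely many values on the fibre, and the coordinates together separate points.
\<close>

lemma finite_fibre:
  assumes C: "subsemiring C" and \<phi>: "finite_morphism C \<Y> \<X> \<phi>" and x: "x \<in> \<X>"
  shows "finite {y \<in> \<Y>. \<phi> y = x}" (is "finite ?F")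
proof -
  from bspec[OF conjunct2[OF \<phi>[unfolded finite_morphism_def Let_def]] x]
  obtain U B where U: "x \<in> U" and aff: "affine_open C \<Y> {y \<in> \<Y>. \<phi> y \<in> U}" and "finite B"
    and gen': "\<forall>b\<in>regular_on C \<Y> {y \<in> \<Y>. \<phi> y \<in> U}. \<exists>a. (\<forall>g\<in>B. a g \<in> regular_on C \<X> U) \<and>
      (\<forall>y\<in>{y \<in> \<Y>. \<phi> y \<in> U}. b y = (\<Sum>g\<in>B. a g (\<phi> y) * g y))"
    by - (elim exE conjE, rule that)
  define V where "V = {y \<in> \<Y>. \<phi> y \<in> U}"
  note gen = gen'[folded V_def]
  obtain N :: nat and f A where f: "\<forall>i<N. f i \<in> regular_on C \<Y> V"
    and bij: "bij_betw (\<lambda>u i. if i < N then f i u else 0) V A"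
    using aff unfolding affine_open_def V_def[symmetric] Let_def
    by - (elim exE conjE, rule that)
  let ?t = "\<lambda>u (i::nat). if i < N then f i u else 0"
  have FV: "?F \<subseteq> V" using U by (auto simp: V_def)
  have fin_i: "finite (f i ` ?F)" if "i < N" for i
  proof (rule finite_if_powers_in_span[OF \<open>finite B\<close>])
    fix k
    have "(\<lambda>z. f i z ^ k) \<in> regular_on C \<Y> V"
      using f that C by (intro regular_on_power) (auto simp: V_def)
    from bspec[OF gen this] obtain a where "\<forall>y\<in>V. f i y ^ k = (\<Sum>g\<in>B. a g (\<phi> y) * g y)"
      by - (elim exE conjE, rule that)
    then show "\<exists>a. \<forall>y\<in>?F. f i y ^ k = (\<Sum>g\<in>B. a g * g y)"
      using FV by (intro exI[of _ "\<lambda>g. a g x"]) auto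
  qed
  have "(\<lambda>y. restrict (\<lambda>i. f i y) {..<N}) ` ?F \<subseteq> (\<Pi>\<^sub>E i\<in>{..<N}. f i ` ?F)" (is "?s ` _ \<subseteq> _")
    by (intro image_subsetI PiE_I) auto
  then have "finite (?s ` ?F)"
    using fin_i by (meson finite_PiE finite_lessThan finite_subset lessThan_iff)
  moreover have "inj_on ?s ?F"
  proof (rule inj_onI)
    fix y z assume yz: "y \<in> ?F" "z \<in> ?F" "?s y = ?s z"
    have "f i y = f i z" if "i < N" for i using fun_cong[OF yz(3), of i] that by simp
    then have "?t y = ?t z" by auto
    then show "y = z" using bij_betw_imp_inj_on[OF bij] yz FV by (auto dest: inj_onD)
  qed
  ultimately show ?thesis by (simp add: finite_image_iff)
qed

section \<open>Dimension zero\<close>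

lemma irreducible_in_singleton: "x \<in> topspace T \<Longrightarrow> irreducible_in T {x}"
  by (auto simp: irreducible_in_def)

lemma irreducible_in_finite:
  assumes "t1_space T" "irreducible_in T Z" "finite Z" "z \<in> Z"
  shows "Z = {z}"
proof -
  have "Z \<subseteq> topspace T" using assms(2) by (simp add: irreducible_in_def)
  then have "closedin T {z}" "closedin T (Z - {z})"
    using assms by (auto simp: t1_space_closedin_finite)
  moreover have "Z \<subseteq> {z} \<union> (Z - {z})" by blast
  ultimately have "Z \<subseteq> {z} \<or> Z \<subseteq> Z - {z}"
    using assms(2) unfolding irreducible_in_def by blast
  then show ?thesis using assms(4) by blast
qed

lemma irreducible_in_closure_image:
  assumes f: "continuous_map S T f" and Z: "irreducible_in S Z"
  shows "irreducible_in T (T closure_of (f ` Z))"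
  unfolding irreducible_in_def
proof (intro conjI allI impI)
  have ZS: "Z \<subseteq> topspace S" and "Z \<noteq> {}" using Z by (auto simp: irreducible_in_def)
  then have sub: "f ` Z \<subseteq> T closure_of (f ` Z)"
    using f by (intro closure_of_subset) (auto simp: continuous_map_def)
  then show "T closure_of (f ` Z) \<noteq> {}" using \<open>Z \<noteq> {}\<close> by blast
  show "T closure_of (f ` Z) \<subseteq> topspace T" by (rule closure_of_subset_topspace)
  fix A B assume AB: "closedin T A \<and> closedin T B \<and> T closure_of (f ` Z) \<subseteq> A \<union> B"
  define pre where "pre D = {x \<in> topspace S. f x \<in> D}" for D
  have "closedin S (pre A)" "closedin S (pre B)"
    using AB closedin_continuous_map_preimage[OF f] by (auto simp: pre_def)
  moreover have "Z \<subseteq> pre A \<union> pre B" using AB sub ZS by (auto simp: pre_def)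
  ultimately have "Z \<subseteq> pre A \<or> Z \<subseteq> pre B" using Z by (auto simp: irreducible_in_def)
  then have "f ` Z \<subseteq> A \<or> f ` Z \<subseteq> B" by (auto simp: pre_def)
  then show "T closure_of (f ` Z) \<subseteq> A \<or> T closure_of (f ` Z) \<subseteq> B"
    using AB closure_of_minimal by blast
qed

text \<open>
  In a chain \<open>Z\<^sub>0 \<subset> Z\<^sub>1\<close> of irreducible closed sets of \<open>S\<close>, the set \<open>Z\<^sub>1\<close> lies in a single fibre, as otherwise
  a point of \<open>f(Z\<^sub>1)\<close> and the closure of \<open>f(Z\<^sub>1)\<close> form a chain in \<open>T\<close>. Being finite and irreducible, \<open>Z\<^sub>1\<close>
  is a point, and \<open>Z\<^sub>0\<close> would be empty.
\<close>

lemma has_dim_0_finite_fibres: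
  assumes f: "continuous_map S T f" and S: "t1_space S" and T: "t1_space T"
    and ne: "topspace S \<noteq> {}" and dim: "has_dim T 0"
    and fib: "\<And>x. x \<in> topspace T \<Longrightarrow> finite {y \<in> topspace S. f y = x}"
  shows "has_dim S 0"
proof -
  obtain y where y: "y \<in> topspace S" using ne by blast
  have "irreducible_chain S 0"
    unfolding irreducible_chain_def
    using irreducible_in_singleton[OF y] closedin_t1_singleton[OF S y]
    by (intro exI[of _ "\<lambda>_. {y}"]) auto
  moreover have "\<not> irreducible_chain S (Suc 0)"
  proof
    assume "irreducible_chain S (Suc 0)"
    then obtain Z where Z: "irreducible_in S (Z 0)" "irreducible_in S (Z (Suc 0))" "Z 0 \<subset> Z (Suc 0)"
      unfolding irreducible_chain_def by blast
    let ?Z = "Z (Suc 0)"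
    obtain z where z: "z \<in> Z 0" using Z(1) by (auto simp: irreducible_in_def)
    have ZS: "?Z \<subseteq> topspace S" using Z(2) by (simp add: irreducible_in_def)
    then have zS: "f z \<in> topspace T" using z Z(3) f by (auto simp: continuous_map_def)
    let ?K = "T closure_of (f ` ?Z)"
    have sub: "f ` ?Z \<subseteq> ?K"
      using ZS f by (intro closure_of_subset) (auto simp: continuous_map_def)
    have "\<not> {f z} \<subset> ?K"
    proof
      assume "{f z} \<subset> ?K"
      then have "irreducible_chain T (Suc 0)"
        unfolding irreducible_chain_def
        using irreducible_in_singleton[OF zS] closedin_t1_singleton[OF T zS]
          irreducible_in_closure_image[OF f Z(2)]
        by (intro exI[of _ "\<lambda>i. if i = 0 then {f z} else ?K"]) auto
      then show False using dim by (simp add: has_dim_def)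
    qed
    then have "?Z \<subseteq> {y \<in> topspace S. f y = f z}" using sub z Z(3) ZS by auto
    then have "finite ?Z" using fib[OF zS] finite_subset by blast
    then have "?Z = {z}" using irreducible_in_finite[OF S Z(2)] z Z(3) by blast
    then show False using z Z(3) by auto
  qed
  ultimately show ?thesis by (simp add: has_dim_def)
qed

section \<open>Pullback of divisors\<close>

text \<open>
  If an element \<open>f\<close> of the stalk of \<open>H\<close> is regular at \<open>\<phi> y\<close> and non-zero there, then its pullback is in
  the stalk of \<open>\<phi>\<^sup>*H\<close>, regular at \<open>y\<close> and non-zero there. Conversely, a function of the stalk of \<open>\<phi>\<^sup>*H\<close> that is regular at \<open>y\<close>
  agrees with some \<open>a \<cdot> (f \<circ> \<phi>)\<close> only on a dense open set, which may miss \<open>y\<close>; both sides are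
  regular at \<open>y\<close>, so they have the same value there, which is \<open>0\<close> if \<open>\<phi> y\<close> is in the support of \<open>H\<close>.
\<close>

lemma divisor_support_pullback:
  assumes \<X>: "\<X> \<subseteq> proj_space" and \<Y>: "\<Y> \<subseteq> proj_space" and \<phi>: "morphism C \<Y> \<X> \<phi>"
  shows "divisor_support \<Y> (pullback_divisor \<Y> \<X> \<phi> H) = {y \<in> \<Y>. \<phi> y \<in> divisor_support \<X> H}"
proof (intro equalityI subsetI)
  fix y assume "y \<in> divisor_support \<Y> (pullback_divisor \<Y> \<X> \<phi> H)"
  then have y: "y \<in> \<Y>"
    and van: "\<And>h. h \<in> pullback_divisor \<Y> \<X> \<phi> H y \<Longrightarrow> regular_at UNIV \<Y> h y \<Longrightarrow> h y = 0"
    by (auto simp: divisor_support_def)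
  have "f (\<phi> y) = 0" if f: "f \<in> H (\<phi> y)" "regular_at UNIV \<X> f (\<phi> y)" for f
  proof -
    have "\<exists>a. regular_at UNIV \<Y> a y \<and> rat_eq \<Y> (\<lambda>z. f (\<phi> z)) (\<lambda>z. a z * f (\<phi> z))"
      using regular_at_const[OF subsemiring_UNIV, of 1 y \<Y>] y rat_eq_refl
      by (intro exI[of _ "\<lambda>_. 1"]) simp
    then have "(\<lambda>z. f (\<phi> z)) \<in> pullback_divisor \<Y> \<X> \<phi> H y"
      unfolding pullback_divisor_def using f y by auto
    then show ?thesis using van regular_at_pullback[OF \<X> \<Y> \<phi> y f(2)] by blast
  qed
  then show "y \<in> {y \<in> \<Y>. \<phi> y \<in> divisor_support \<X> H}"
    using y \<phi> by (auto simp: divisor_support_def morphism_def)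
next
  fix y assume "y \<in> {y \<in> \<Y>. \<phi> y \<in> divisor_support \<X> H}"
  then have y: "y \<in> \<Y>" and supp: "\<phi> y \<in> divisor_support \<X> H" by auto
  have "h y = 0" if h: "h \<in> pullback_divisor \<Y> \<X> \<phi> H y" "regular_at UNIV \<Y> h y" for h
  proof -
    obtain f a where f: "f \<in> H (\<phi> y)" "regular_at UNIV \<X> f (\<phi> y)"
      and a: "regular_at UNIV \<Y> a y" "rat_eq \<Y> h (\<lambda>z. a z * f (\<phi> z))"
      using h(1) y by (auto simp: pullback_divisor_def)
    have "regular_at UNIV \<Y> (\<lambda>z. a z * f (\<phi> z)) y"
      by (intro regular_at_mult subsemiring_UNIV a regular_at_pullback[OF \<X> \<Y> \<phi> y] f)
    from regular_at_eqI[OF \<Y> h(2) this a(2)] have "h y = a y * f (\<phi> y)" .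
    then show ?thesis using supp f by (simp add: divisor_support_def)
  qed
  then show "y \<in> divisor_support \<Y> (pullback_divisor \<Y> \<X> \<phi> H)"
    using y by (auto simp: divisor_support_def)
qed

theorem proposition1p28:
  fixes \<X> :: "('a::{field,finite} alg_closure, 'n::finite) point set"
    and \<Y> :: "('a alg_closure, 'm::finite) point set"
    and \<phi> :: "('a alg_closure, 'm) point \<Rightarrow> ('a alg_closure, 'n) point"
    and P :: "('a alg_closure, 'n) point set"
    and P\<^sub>0 :: "('a alg_closure, 'm) point set"
    and \<Gamma> :: "('a alg_closure, 'n) divisor set"
  assumes "smooth_projective_surface \<X>" and "geometrically_connected \<X>"
    and "smooth_projective_surface \<Y>" and "geometrically_connected \<Y>"
    and "finite_morphism base_field \<Y> \<X> \<phi>"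
    and "P \<noteq> {}" and "P \<subseteq> rational_points \<X>"
    and "P\<^sub>0 \<noteq> {}" and "P\<^sub>0 \<subseteq> rational_points \<Y>"
    and "\<phi> ` P\<^sub>0 \<subseteq> P"
    and "linear_system \<X> \<Gamma>" and "interpolating \<X> P \<Gamma>"
  shows "interpolating \<Y> P\<^sub>0 (pullback_system \<Y> \<X> \<phi> \<Gamma>)"
proof -
  have \<X>: "\<X> \<subseteq> proj_space" and \<Y>: "\<Y> \<subseteq> proj_space"
    using assms(1,3) projective_over_proj_space by (auto simp: smooth_projective_surface_def)
  have \<phi>: "morphism base_field \<Y> \<X> \<phi>"
    using assms(5) by (simp add: finite_morphism_def)
  have P0: "P\<^sub>0 \<subseteq> \<Y>" using assms(9) by (auto simp: rational_points_def)
  note supp = divisor_support_pullback[OF \<X> \<Y> \<phi>]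
  let ?\<Delta> = "subsystem_through \<X> \<Gamma> P"
  let ?\<Delta>' = "subsystem_through \<Y> (pullback_system \<Y> \<X> \<phi> \<Gamma>) P\<^sub>0"
  let ?B = "base_locus \<X> ?\<Delta>"
  let ?B' = "base_locus \<Y> ?\<Delta>'"
  have \<Delta>': "pullback_divisor \<Y> \<X> \<phi> H \<in> ?\<Delta>'" if "H \<in> ?\<Delta>" for H
    using that P0 assms(10) by (auto simp: subsystem_through_def pullback_system_def supp)
  have \<phi>B: "\<phi> y \<in> ?B" if "y \<in> ?B'" for y
    using that \<Delta>' \<phi> supp by (fastforce simp: base_locus_def morphism_def)
  have B'\<Y>: "?B' \<subseteq> \<Y>" and BX: "?B \<subseteq> \<X>" by (auto simp: base_locus_def)
  have P0B: "P\<^sub>0 \<subseteq> ?B'" using P0 by (auto simp: base_locus_def subsystem_through_def)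
  let ?S = "subtopology (zariski UNIV \<Y>) ?B'"
  let ?T = "subtopology (zariski UNIV \<X>) ?B"
  have tops: "topspace ?S = ?B'" "topspace ?T = ?B"
    using B'\<Y> BX by (auto simp: topspace_zariski[OF subsemiring_UNIV])
  have "has_dim ?S 0"
  proof (rule has_dim_0_finite_fibres)
    show "continuous_map ?S ?T \<phi>"
      using continuous_map_from_subtopology[OF continuous_map_morphism[OF \<X> \<Y> \<phi>]] \<phi>B tops(1)
      by (auto simp: continuous_map_in_subtopology)
    show "t1_space ?S" "t1_space ?T"
      by (intro t1_space_subtopology t1_space_zariski \<X> \<Y>)+
    show "topspace ?S \<noteq> {}" using P0B assms(8) tops by blast
    show "has_dim ?T 0" using assms(12) by (simp add: interpolating_def)
    fix x assume "x \<in> topspace ?T"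
    then have "finite {y \<in> \<Y>. \<phi> y = x}"
      using finite_fibre[OF subsemiring_base_field assms(5)] tops BX by blast
    then show "finite {y \<in> topspace ?S. \<phi> y = x}"
      using B'\<Y> tops by (auto elim: rev_finite_subset)
  qed
  moreover have "?\<Delta>' \<noteq> {}" using \<Delta>' assms(12) by (auto simp: interpolating_def)
  ultimately show ?thesis by (simp add: interpolating_def)
qed

end
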